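(* Let $\mathcal{R}$ be a finite chain ring. For an arbitrary subset $\mathcal{C}\subseteq\mathcal{R}^n$ with minimum homogeneous distance $d$, it holds that $$d\le\frac{|\mathcal{C}|}{|\mathcal{C}|-1}\,n.$$ If $\mathcal{C}$ is a linear code, equality is achieved if and only if $\mathcal{C}$ has constant weight, i.e., $\mathrm{wt}_{\mathrm{Hom}}(c)=d$ for all $c\in\mathcal{C}\setminus\{0\}$.
   Context: $\mathcal{R}$ is a finite chain ring (not necessarily commutative) with maximal ideal $\langle\gamma\rangle$ generated by $\gamma$; $s$ is the nilpotency index of $\gamma$ (least positive integer with $\gamma^s=0$; $\gamma^0=1$); $q$ is the size of the residue field $\mathcal{R}/\langle\gamma\rangle$; $n$ is a positive integer. Homogeneous weight: for $x\in\mathcal{R}$, $\mathrm{wt}_{\mathrm{Hom}}(x)=0$ if $x=0$, $=\frac{q}{q-1}$ if $x\in\langle\gamma^{s-1}\rangle\setminus\{0\}$, and $=1$ if $x\notin\langle\gamma^{s-1}\rangle$. For $x\in\mathcal{R}^n$, $\mathrm{wt}_{\mathrm{Hom}}(x)=\sum_{i=1}^n\mathrm{wt}_{\mathrm{Hom}}(x_i)$. The minimum homogeneous distance of a subset $\mathcal{C}\subseteq\mathcal{R}^n$ is $d_{\mathrm{Hom}}(\mathcal{C})=\min\{\mathrm{wt}_{\mathrm{Hom}}(x-y): x,y\in\mathcal{C},\ x\ne y\}$. A linear code of length $n$ is a left $\mathcal{R}$-submodule of $\mathcal{R}^n$.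
   Formalization: "Constant weight implies equality" is proved only for linear codes with no identically zero coordinate, since it fails otherwise (over F_2, C={00,10} has d=2 but the bound is 4); C is assumed to have at least two elements so that d is defined. *)

theory Defs
  imports Complex_Main "HOL-Library.FuncSet" "HOL-Algebra.Algebra"
begin

definition left_ideal :: "'a set \<Rightarrow> ('a, 'm) ring_scheme \<Rightarrow> bool" where
  "left_ideal I R \<longleftrightarrow>
     additive_subgroup I R \<and> (\<forall>r \<in> carrier R. \<forall>x \<in> I. r \<otimes>\<^bsub>R\<^esub> x \<in> I)"

(* For finite rings the chain condition on left ideals is equivalent to that on right ideals,
   and to the ring being local with principal maximal ideal; commutativity is not assumed. *)
locale finite_chain_ring = ring R for R (structure) +
  assumes finite_carrier: "finite (carrier R)"
    and one_not_zero: "\<one> \<noteq> \<zero>"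
    and left_ideals_chain: "left_ideal I R \<Longrightarrow> left_ideal J R \<Longrightarrow> I \<subseteq> J \<or> J \<subseteq> I"

definition nilpotency_index :: "('a, 'm) ring_scheme \<Rightarrow> 'a \<Rightarrow> nat" where
  "nilpotency_index R x = (LEAST k. 0 < k \<and> x [^]\<^bsub>R\<^esub> k = \<zero>\<^bsub>R\<^esub>)"

definition residue_size :: "('a, 'm) ring_scheme \<Rightarrow> 'a \<Rightarrow> nat" where
  "residue_size R \<gamma> = card (carrier (R Quot (Idl\<^bsub>R\<^esub> {\<gamma>})))"

definition hom_weight :: "('a, 'm) ring_scheme \<Rightarrow> 'a \<Rightarrow> 'a \<Rightarrow> real" where
  "hom_weight R \<gamma> x =
     (if x = \<zero>\<^bsub>R\<^esub> then 0
      else if x \<in> Idl\<^bsub>R\<^esub> {\<gamma> [^]\<^bsub>R\<^esub> (nilpotency_index R \<gamma> - 1)}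
        then real (residue_size R \<gamma>) / (real (residue_size R \<gamma>) - 1)
      else 1)"

(* Vectors of length n are functions on {1..n}, with the value undefined outside this index
   set, so that equality of vectors is equality of functions. *)
definition vectors :: "('a, 'm) ring_scheme \<Rightarrow> nat \<Rightarrow> (nat \<Rightarrow> 'a) set" where
  "vectors R n = {1..n} \<rightarrow>\<^sub>E carrier R"

definition vec_zero :: "('a, 'm) ring_scheme \<Rightarrow> nat \<Rightarrow> nat \<Rightarrow> 'a" where
  "vec_zero R n = (\<lambda>i\<in>{1..n}. \<zero>\<^bsub>R\<^esub>)"

definition vec_add :: "('a, 'm) ring_scheme \<Rightarrow> nat \<Rightarrow> (nat \<Rightarrow> 'a) \<Rightarrow> (nat \<Rightarrow> 'a) \<Rightarrow> nat \<Rightarrow> 'a" where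
  "vec_add R n x y = (\<lambda>i\<in>{1..n}. x i \<oplus>\<^bsub>R\<^esub> y i)"

definition vec_diff :: "('a, 'm) ring_scheme \<Rightarrow> nat \<Rightarrow> (nat \<Rightarrow> 'a) \<Rightarrow> (nat \<Rightarrow> 'a) \<Rightarrow> nat \<Rightarrow> 'a" where
  "vec_diff R n x y = (\<lambda>i\<in>{1..n}. x i \<ominus>\<^bsub>R\<^esub> y i)"

definition vec_lsmult :: "('a, 'm) ring_scheme \<Rightarrow> nat \<Rightarrow> 'a \<Rightarrow> (nat \<Rightarrow> 'a) \<Rightarrow> nat \<Rightarrow> 'a" where
  "vec_lsmult R n r x = (\<lambda>i\<in>{1..n}. r \<otimes>\<^bsub>R\<^esub> x i)"

definition hom_weight_vec :: "('a, 'm) ring_scheme \<Rightarrow> 'a \<Rightarrow> nat \<Rightarrow> (nat \<Rightarrow> 'a) \<Rightarrow> real" where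
  "hom_weight_vec R \<gamma> n x = (\<Sum>i=1..n. hom_weight R \<gamma> (x i))"

(* Meaningful only if C is finite and has at least two elements. *)
definition min_hom_dist :: "('a, 'm) ring_scheme \<Rightarrow> 'a \<Rightarrow> nat \<Rightarrow> (nat \<Rightarrow> 'a) set \<Rightarrow> real" where
  "min_hom_dist R \<gamma> n C =
     Min {hom_weight_vec R \<gamma> n (vec_diff R n x y) | x y. x \<in> C \<and> y \<in> C \<and> x \<noteq> y}"

(* The library locales for modules and submodules require a commutative ring of scalars, so
   left submodules are spelled out; closure under negation follows by scaling with -1. *)
definition linear_code :: "('a, 'm) ring_scheme \<Rightarrow> nat \<Rightarrow> (nat \<Rightarrow> 'a) set \<Rightarrow> bool" where
  "linear_code R n C \<longleftrightarrow>
     C \<subseteq> vectors R n \<and> vec_zero R n \<in> C \<and>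
     (\<forall>x \<in> C. \<forall>y \<in> C. vec_add R n x y \<in> C) \<and>
     (\<forall>r \<in> carrier R. \<forall>x \<in> C. vec_lsmult R n r x \<in> C)"

definition constant_hom_weight ::
    "('a, 'm) ring_scheme \<Rightarrow> 'a \<Rightarrow> nat \<Rightarrow> (nat \<Rightarrow> 'a) set \<Rightarrow> bool" where
  "constant_hom_weight R \<gamma> n C \<longleftrightarrow>
     (\<forall>c \<in> C - {vec_zero R n}. hom_weight_vec R \<gamma> n c = min_hom_dist R \<gamma> n C)"

(* No coordinate vanishes on all of C.  A constant weight linear code with an identically zero
   coordinate cannot attain the bound |C| n / (|C| - 1): over the field with two elements,
   C = {00, 10} has constant weight 2, whereas the bound is 4. *)
definition nondegenerate_code :: "('a, 'm) ring_scheme \<Rightarrow> nat \<Rightarrow> (nat \<Rightarrow> 'a) set \<Rightarrow> bool" where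
  "nondegenerate_code R n C \<longleftrightarrow> (\<forall>i \<in> {1..n}. \<exists>c \<in> C. c i \<noteq> \<zero>\<^bsub>R\<^esub>)"

end

theory Submission
  imports Defs
begin

text \<open>
  The nonunits form an ideal, which equals \<open>R\<gamma>\<close>; so \<open>r \<mapsto> r\<gamma>\<^sup>s\<^sup>-\<^sup>1\<close> has the maximal ideal as its kernel,
  and its image \<open>S = \<langle>\<gamma>\<^sup>s\<^sup>-\<^sup>1\<rangle>\<close> has \<open>q\<close> elements and lies in every nonzero left ideal.  The weight of \<open>a\<close> is
  \<open>1 + ([a \<in> S] - q [a = 0]) / (q - 1)\<close>.  If \<open>m a\<close> counts the codewords with entry \<open>a\<close> in a fixed
  coordinate, then \<open>2 m(a) m(a + t) \<le> m(a)\<^sup>2 + m(a + t)\<^sup>2\<close>, summed over \<open>a\<close> and over \<open>t \<in> S\<close>, shows that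
  pairs with difference in \<open>S\<close> are at most \<open>q\<close> times as many as pairs that agree.  Hence each
  coordinate contributes at most \<open>|C|\<^sup>2\<close> to the sum of all distances.  In a linear code whose
  \<open>i\<close>-th coordinate is not identically zero, each \<open>t \<in> S\<close> is the \<open>i\<close>-th entry of a codeword, and
  translation by it shows that \<open>t\<close> occurs as often as \<open>0\<close>; the \<open>i\<close>-th entries then have total
  weight exactly \<open>|C|\<close>.
\<close>

section \<open>Finite chain rings\<close>

definition (in ring) left_multiples :: "'a \<Rightarrow> 'a set" where
  "left_multiples x = (\<lambda>r. r \<otimes> x) ` carrier R"

lemma (in ring) left_ideal_left_multiples:
  assumes x: "x \<in> carrier R"
  shows "left_ideal (left_multiples x) R"
  unfolding left_ideal_def left_multiples_def
proof (intro conjI ballI)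
  show "additive_subgroup ((\<lambda>r. r \<otimes> x) ` carrier R) R"
  proof (rule additive_subgroup.intro, rule add.subgroupI)
    show "(\<lambda>r. r \<otimes> x) ` carrier R \<subseteq> carrier R" "(\<lambda>r. r \<otimes> x) ` carrier R \<noteq> {}"
      using x by auto
  next
    fix a assume "a \<in> (\<lambda>r. r \<otimes> x) ` carrier R"
    then obtain r where "r \<in> carrier R" "a = r \<otimes> x" by auto
    then show "\<ominus> a \<in> (\<lambda>r. r \<otimes> x) ` carrier R"
      using x by (intro image_eqI[of _ _ "\<ominus> r"]) (simp_all add: l_minus)
  next
    fix a b assume "a \<in> (\<lambda>r. r \<otimes> x) ` carrier R" "b \<in> (\<lambda>r. r \<otimes> x) ` carrier R"
    then obtain r r' where "r \<in> carrier R" "a = r \<otimes> x" "r' \<in> carrier R" "b = r' \<otimes> x" by auto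
    then show "a \<oplus> b \<in> (\<lambda>r. r \<otimes> x) ` carrier R"
      using x by (intro image_eqI[of _ _ "r \<oplus> r'"]) (simp_all add: l_distr)
  qed
next
  fix r y assume "r \<in> carrier R" "y \<in> (\<lambda>r. r \<otimes> x) ` carrier R"
  then obtain r' where "r \<in> carrier R" "y = r' \<otimes> x" "r' \<in> carrier R" by auto
  then show "r \<otimes> y \<in> (\<lambda>r. r \<otimes> x) ` carrier R"
    using x by (intro image_eqI[of _ _ "r \<otimes> r'"]) (simp_all add: m_assoc)
qed

lemma (in ring) left_multiples_self: "x \<in> carrier R \<Longrightarrow> x \<in> left_multiples x"
  unfolding left_multiples_def by (auto intro!: image_eqI[of _ _ \<one>])

text \<open>Left multiplication by \<open>x\<close> is injective, since \<open>y\<close> cancels it,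
  hence surjective on the finite carrier. The resulting right inverse of \<open>x\<close> coincides
  with \<open>y\<close>.\<close>

lemma (in monoid) finite_left_inverse_Units:
  assumes fin: "finite (carrier G)" and x: "x \<in> carrier G" and y: "y \<in> carrier G"
    and yx: "y \<otimes> x = \<one>"
  shows "x \<in> Units G" "y \<in> Units G"
proof -
  have "inj_on (\<lambda>r. x \<otimes> r) (carrier G)"
  proof (rule inj_onI)
    fix a b assume ab: "a \<in> carrier G" "b \<in> carrier G" and "x \<otimes> a = x \<otimes> b"
    then have "y \<otimes> x \<otimes> a = y \<otimes> x \<otimes> b" using x y by (simp add: m_assoc)
    then show "a = b" using ab yx by simp
  qed
  moreover have "(\<lambda>r. x \<otimes> r) ` carrier G \<subseteq> carrier G" using x by auto
  ultimately have "(\<lambda>r. x \<otimes> r) ` carrier G = carrier G"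
    using fin by (simp add: endo_inj_surj)
  then obtain z where z: "z \<in> carrier G" "x \<otimes> z = \<one>"
    by (metis imageE one_closed)
  have "y = y \<otimes> (x \<otimes> z)" using y z by simp
  also have "\<dots> = y \<otimes> x \<otimes> z" using x y z by (simp add: m_assoc)
  also have "\<dots> = z" using z yx by simp
  finally have "x \<otimes> y = \<one>" using z by simp
  then show "x \<in> Units G" "y \<in> Units G" using x y yx by (auto simp: Units_def)
qed

section \<open>The ideal of nonunits\<close>

context finite_chain_ring
begin

text \<open>If \<open>r \<otimes> x\<close> were a unit, its inverse times \<open>r\<close> would be
  a left inverse of \<open>x\<close>, which finiteness makes two-sided.\<close>

lemma nonunit_mult_left:
  "x \<in> carrier R \<Longrightarrow> x \<notin> Units R \<Longrightarrow> r \<in> carrier R \<Longrightarrow> r \<otimes> x \<notin> Units R"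
  by (metis Units_closed Units_inv_closed Units_l_inv finite_carrier
      finite_left_inverse_Units(1) m_assoc m_closed)

lemma nonunit_mult_right:
  "x \<in> carrier R \<Longrightarrow> x \<notin> Units R \<Longrightarrow> r \<in> carrier R \<Longrightarrow> x \<otimes> r \<notin> Units R"
  by (metis Units_closed Units_inv_closed Units_r_inv finite_carrier
      finite_left_inverse_Units(2) m_assoc m_closed)

text \<open>By the chain condition one summand is a left multiple \<open>r \<otimes> b\<close> of
  the other, so the sum is \<open>(r \<oplus> \<one>) \<otimes> b\<close>, a left multiple of a
  nonunit.\<close>

lemma nonunit_add:
  assumes x: "x \<in> carrier R" "x \<notin> Units R" and y: "y \<in> carrier R" "y \<notin> Units R"
  shows "x \<oplus> y \<notin> Units R"
proof -
  have *: "a \<oplus> b \<notin> Units R"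
    if b: "b \<in> carrier R" "b \<notin> Units R" and ab: "left_multiples a \<subseteq> left_multiples b"
      and a: "a \<in> carrier R" for a b
  proof -
    obtain r where "r \<in> carrier R" "a = r \<otimes> b"
      using left_multiples_self[OF a] ab by (auto simp: left_multiples_def)
    then have "a \<oplus> b = (r \<oplus> \<one>) \<otimes> b" using b by (simp add: l_distr)
    then show ?thesis using nonunit_mult_left b \<open>r \<in> carrier R\<close> by simp
  qed
  show ?thesis
    using left_ideals_chain[OF left_ideal_left_multiples[OF x(1)] left_ideal_left_multiples[OF y(1)]]
      *[OF y _ x(1)] *[OF x _ y(1)] a_comm[OF x(1) y(1)] by auto
qed

lemma ideal_nonunits: "ideal (carrier R - Units R) R"
proof (rule idealI[OF ring_axioms])
  have "\<zero> \<notin> Units R"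
    using one_not_zero by (auto simp: Units_def)
  moreover have "\<ominus> a \<notin> Units R" if "a \<in> carrier R" "a \<notin> Units R" for a
    using nonunit_mult_left[OF that, of "\<ominus> \<one>"] that by (simp add: l_minus)
  ultimately show "subgroup (carrier R - Units R) (add_monoid R)"
    by (intro add.subgroupI) (auto dest: nonunit_add)
qed (auto dest: nonunit_mult_left nonunit_mult_right)

text \<open>A proper ideal contains no unit, so it lies in the proper ideal of nonunits; maximality
  leaves only equality.\<close>

lemma maximalideal_eq_nonunits:
  assumes "maximalideal I R"
  shows "I = carrier R - Units R"
proof -
  interpret maximalideal I R by fact
  have "I \<subseteq> carrier R - Units R"
  proof
    fix x assume "x \<in> I"
    have "x \<notin> Units R"
    proof
      assume "x \<in> Units R"
      then have "\<one> \<in> I" using I_l_closed[OF \<open>x \<in> I\<close>, of "inv x"] by simp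
      then show False using one_imp_carrier I_notcarr by simp
    qed
    then show "x \<in> carrier R - Units R" using \<open>x \<in> I\<close> by auto
  qed
  moreover have "carrier R - Units R \<noteq> carrier R" using Units_one_closed by blast
  ultimately show ?thesis using I_maximal[OF ideal_nonunits] by auto
qed

text \<open>A nonunit \<open>p\<close> whose principal left ideal has the most elements is a
  generator: any \<open>left_multiples x\<close> is comparable with \<open>left_multiples p\<close>,
  and if it is the larger one, cardinality forces equality.\<close>

lemma nonunits_principal:
  obtains p where "p \<in> carrier R - Units R" "carrier R - Units R = left_multiples p"
proof -
  let ?N = "carrier R - Units R"
  interpret N: ideal ?N R by (rule ideal_nonunits)
  have fin: "finite ?N" and ne: "?N \<noteq> {}" using finite_carrier N.zero_closed by auto
  obtain p where p: "p \<in> ?N"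
    and Max: "Max ((\<lambda>x. card (left_multiples x)) ` ?N) = card (left_multiples p)"
    by (rule obtains_MAX[OF fin ne])
  have max: "card (left_multiples x) \<le> card (left_multiples p)" if "x \<in> ?N" for x
    unfolding Max[symmetric] using fin that by (intro Max_ge) auto
  have "?N \<subseteq> left_multiples p"
  proof
    fix x assume x: "x \<in> ?N"
    have "finite (left_multiples x)" using finite_carrier by (simp add: left_multiples_def)
    then have "left_multiples x \<subseteq> left_multiples p"
      using left_ideals_chain[of "left_multiples x" "left_multiples p"] max[OF x] p x
      by (metis DiffD1 card_seteq left_ideal_left_multiples order_refl)
    then show "x \<in> left_multiples p" using left_multiples_self x by blast
  qed
  moreover have "left_multiples p \<subseteq> ?N" using p N.I_l_closed by (auto simp: left_multiples_def)
  ultimately show thesis using that p by blast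
qed

text \<open>Associativity moves a right factor of \<open>b \<otimes> x\<close> onto
  \<open>x\<close>, so closure on the right need only be checked at the generator.\<close>

lemma ideal_left_multiples:
  assumes x: "x \<in> carrier R" and r: "\<And>r. r \<in> carrier R \<Longrightarrow> x \<otimes> r \<in> left_multiples x"
  shows "ideal (left_multiples x) R"
proof (rule idealI[OF ring_axioms])
  have l: "left_ideal (left_multiples x) R" by (rule left_ideal_left_multiples[OF x])
  then show "subgroup (left_multiples x) (add_monoid R)"
    by (auto simp: left_ideal_def additive_subgroup_def)
  show "y \<otimes> a \<in> left_multiples x" if "a \<in> left_multiples x" "y \<in> carrier R" for a y
    using l that by (auto simp: left_ideal_def)
  show "a \<otimes> y \<in> left_multiples x" if a: "a \<in> left_multiples x" and y: "y \<in> carrier R" for a y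
  proof -
    obtain b where "b \<in> carrier R" "a = b \<otimes> x" using a by (auto simp: left_multiples_def)
    then have "a \<otimes> y = b \<otimes> (x \<otimes> y)" using x y by (simp add: m_assoc)
    then show ?thesis using l r[OF y] \<open>b \<in> carrier R\<close> by (auto simp: left_ideal_def)
  qed
qed

text \<open>A scalar passes through the power one factor at a time and may change at each passage,
  hence the induction over all \<open>t\<close>. This makes the left ideals generated by powers
  two-sided.\<close>

lemma left_multiples_pow_right_closed:
  assumes x: "x \<in> carrier R" and r: "\<And>r. r \<in> carrier R \<Longrightarrow> x \<otimes> r \<in> left_multiples x"
    and "t \<in> carrier R"
  shows "x [^] (k::nat) \<otimes> t \<in> left_multiples (x [^] k)"
  using \<open>t \<in> carrier R\<close>
proof (induction k arbitrary: t)
  case 0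
  then show ?case by (auto simp: left_multiples_def)
next
  case (Suc k)
  obtain t' where t': "t' \<in> carrier R" "x \<otimes> t = t' \<otimes> x"
    using r[OF Suc.prems] by (auto simp: left_multiples_def)
  obtain t'' where t'': "t'' \<in> carrier R" "x [^] k \<otimes> t' = t'' \<otimes> x [^] k"
    using Suc.IH[OF t'(1)] by (auto simp: left_multiples_def)
  have "x [^] Suc k \<otimes> t = x [^] k \<otimes> (x \<otimes> t)" using x Suc.prems by (simp add: m_assoc)
  also have "\<dots> = x [^] k \<otimes> t' \<otimes> x" using t' x by (simp add: m_assoc)
  also have "\<dots> = t'' \<otimes> x [^] Suc k" using t'' x by (simp add: m_assoc)
  finally show ?case using t'' by (auto simp: left_multiples_def)
qed

text \<open>A case of Nakayama's lemma: \<open>\<one> \<ominus> a\<close> annihilates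
  \<open>x\<close>, and it is a unit because otherwise \<open>\<one>\<close> would be a sum of two
  nonunits.\<close>

lemma nonunit_fixes_imp_zero:
  assumes a: "a \<in> carrier R" "a \<notin> Units R" and x: "x \<in> carrier R" and ax: "a \<otimes> x = x"
  shows "x = \<zero>"
proof -
  have "\<one> = (\<one> \<ominus> a) \<oplus> a" using a by (simp add: minus_eq a_assoc l_neg)
  then have u: "\<one> \<ominus> a \<in> Units R" using nonunit_add[of "\<one> \<ominus> a" a] a by auto
  have "(\<one> \<ominus> a) \<otimes> x = \<zero>" using a x ax by (simp add: minus_eq l_distr l_minus r_neg)
  then show ?thesis using u x
    by (metis Units_closed Units_inv_closed Units_l_inv l_one m_assoc r_null)
qed

text \<open>Finiteness forces \<open>x [^] i = x [^] j\<close> with \<open>i < j\<close>, so the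
  nonunit \<open>x [^] (j - i)\<close> fixes \<open>x [^] i\<close>.\<close>

lemma nonunit_nilpotent:
  assumes x: "x \<in> carrier R" "x \<notin> Units R"
  obtains k :: nat where "x [^] k = \<zero>"
proof -
  have "\<not> inj (\<lambda>k::nat. x [^] k)"
  proof
    assume "inj (\<lambda>k::nat. x [^] k)"
    moreover have "range (\<lambda>k::nat. x [^] k) \<subseteq> carrier R" using x by auto
    ultimately show False using finite_carrier finite_subset infinite_UNIV_nat finite_imageD by metis
  qed
  then obtain i j :: nat where ij: "i < j" "x [^] i = x [^] j"
    unfolding inj_def by (metis linorder_neqE_nat)
  define m where "m = j - i - 1"
  have "x [^] j = x [^] Suc m \<otimes> x [^] i"
    using ij x nat_pow_mult[of x "Suc m" i] by (simp add: m_def)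
  moreover have "x [^] Suc m \<notin> Units R" using x nonunit_mult_left[of x] by simp
  ultimately have "x [^] i = \<zero>"
    using nonunit_fixes_imp_zero[of "x [^] Suc m" "x [^] i"] ij x by simp
  then show thesis using that by blast
qed

end

section \<open>The generator \<open>\<gamma>\<close> and the socle\<close>

locale finite_chain_ring_uniformizer = finite_chain_ring +
  fixes \<gamma> :: 'a
  assumes gamma_carrier [simp]: "\<gamma> \<in> carrier R"
    and maximal_gamma: "maximalideal (Idl {\<gamma>}) R"
begin

lemma Idl_gamma: "Idl {\<gamma>} = carrier R - Units R"
  using maximalideal_eq_nonunits[OF maximal_gamma] .

lemma gamma_nonunit: "\<gamma> \<notin> Units R"
  using genideal_self'[OF gamma_carrier] Idl_gamma by auto

text \<open>
  The generator \<open>\<gamma>\<close> generates the nonunits only as a two-sided ideal.  If \<open>\<gamma> = u p\<close> for a left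
  generator \<open>p\<close> and a nonunit \<open>u\<close>, then \<open>\<gamma>\<close> lies in the two-sided ideal \<open>Rp\<^sup>2\<close>, so \<open>p \<in> Rp\<^sup>2\<close> and \<open>p = 0\<close>.
\<close>

lemma nonunits_eq: "carrier R - Units R = left_multiples \<gamma>"
proof -
  let ?N = "carrier R - Units R"
  interpret N: ideal ?N R by (rule ideal_nonunits)
  obtain p where p: "p \<in> ?N" and Np: "?N = left_multiples p" by (rule nonunits_principal)
  have pc: "p \<in> carrier R" using p by simp
  have p_right: "p \<otimes> r \<in> left_multiples p" if "r \<in> carrier R" for r
    using N.I_r_closed[OF p that] Np by simp
  have "\<gamma> \<in> ?N" using gamma_nonunit by simp
  then obtain u where u: "u \<in> carrier R" "\<gamma> = u \<otimes> p" using Np by (auto simp: left_multiples_def)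
  show ?thesis
  proof (cases "u \<in> Units R")
    case True
    have "p = inv u \<otimes> \<gamma>" using u True pc by (simp flip: m_assoc)
    then have "left_multiples p \<subseteq> left_multiples \<gamma>"
      using True by (auto simp: left_multiples_def intro!: image_eqI[of _ _ "_ \<otimes> inv u"] simp flip: m_assoc)
    moreover have "left_multiples \<gamma> \<subseteq> ?N"
      using N.I_l_closed[OF \<open>\<gamma> \<in> ?N\<close>] by (auto simp: left_multiples_def)
    ultimately show ?thesis using Np by auto
  next
    case False
    then obtain v where v: "v \<in> carrier R" "u = v \<otimes> p"
      using u(1) Np by (auto simp: left_multiples_def)
    have "ideal (left_multiples (p [^] (2::nat))) R"
      by (intro ideal_left_multiples left_multiples_pow_right_closed p_right) (use pc in auto)
    moreover have "\<gamma> \<in> left_multiples (p [^] (2::nat))"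
      using u v pc by (auto simp: left_multiples_def numeral_2_eq_2 m_assoc)
    ultimately have "p \<in> left_multiples (p [^] (2::nat))"
      using genideal_minimal[of _ "{\<gamma>}"] Idl_gamma p by blast
    then obtain w where w: "w \<in> carrier R" "p = w \<otimes> p \<otimes> p"
      using pc by (auto simp: left_multiples_def numeral_2_eq_2 m_assoc)
    then have "p = \<zero>"
      using nonunit_fixes_imp_zero[of "w \<otimes> p" p] nonunit_mult_left[of p w] p by auto
    then show ?thesis using Np u by (simp add: left_multiples_def)
  qed
qed

definition "s = nilpotency_index R \<gamma>"

definition "socle_gen = \<gamma> [^] (s - 1)"

lemma s_props: "0 < s" "\<gamma> [^] s = \<zero>" "socle_gen \<noteq> \<zero>"
proof -
  obtain k :: nat where "\<gamma> [^] k = \<zero>" using nonunit_nilpotent[OF gamma_carrier gamma_nonunit] .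
  then have "0 < k \<and> \<gamma> [^] k = \<zero>" using one_not_zero by (cases k) auto
  then have "0 < s \<and> \<gamma> [^] s = \<zero>" unfolding s_def nilpotency_index_def by (rule LeastI)
  then show *: "0 < s" "\<gamma> [^] s = \<zero>" by auto
  show "socle_gen \<noteq> \<zero>"
  proof
    assume "socle_gen = \<zero>"
    \<comment> \<open>If \<open>s = 1\<close>, then \<open>socle_gen\<close> is
      \<open>\<one>\<close>, which is nonzero; so \<open>s - 1\<close> is a smaller positive
      exponent, against the minimality of \<open>s\<close>.\<close>
    then have "s - 1 \<noteq> 0" "\<gamma> [^] (s - 1) = \<zero>"
      using one_not_zero by (auto simp: socle_gen_def intro: Nat.gr0I)
    then show False
      using not_less_Least[of "s - 1" "\<lambda>k. 0 < k \<and> \<gamma> [^] k = \<zero>"] *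
      by (auto simp: s_def nilpotency_index_def)
  qed
qed

lemma socle_gen_carrier [simp]: "socle_gen \<in> carrier R"
  by (simp add: socle_gen_def)

text \<open>The form as a left ideal gives explicit multipliers of \<open>socle_gen\<close>;
  \<open>Idl_socle_gen\<close> identifies it with the two-sided ideal in the definition of the
  weight.\<close>

definition "socle = left_multiples socle_gen"

lemma ideal_socle: "ideal socle R"
proof -
  interpret N: ideal "carrier R - Units R" R by (rule ideal_nonunits)
  have "\<gamma> \<otimes> r \<in> left_multiples \<gamma>" if "r \<in> carrier R" for r
    using N.I_r_closed[of \<gamma> r] gamma_nonunit that by (simp flip: nonunits_eq)
  then show ?thesis
    unfolding socle_def socle_gen_def
    by (intro ideal_left_multiples left_multiples_pow_right_closed) auto
qed

lemma Idl_socle_gen: "Idl {\<gamma> [^] (nilpotency_index R \<gamma> - 1)} = socle"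
proof
  show "Idl {\<gamma> [^] (nilpotency_index R \<gamma> - 1)} \<subseteq> socle"
    using left_multiples_self[OF socle_gen_carrier]
    by (intro genideal_minimal[OF ideal_socle]) (auto simp: socle_def socle_gen_def s_def)
  interpret I: ideal "Idl {\<gamma> [^] (nilpotency_index R \<gamma> - 1)}" R
    by (rule genideal_ideal) simp
  show "socle \<subseteq> Idl {\<gamma> [^] (nilpotency_index R \<gamma> - 1)}"
    using I.I_l_closed[OF genideal_self'] by (auto simp: socle_def left_multiples_def socle_gen_def s_def)
qed

text \<open>The left annihilator of \<open>socle_gen\<close> is the maximal ideal: a unit can be
  cancelled, and a nonunit is \<open>t \<otimes> \<gamma>\<close> with
  \<open>\<gamma> \<otimes> socle_gen = \<gamma> [^] s = \<zero>\<close>.\<close>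

lemma mult_socle_gen_eq_zero_iff:
  assumes r: "r \<in> carrier R"
  shows "r \<otimes> socle_gen = \<zero> \<longleftrightarrow> r \<notin> Units R"
proof
  assume "r \<otimes> socle_gen = \<zero>"
  then show "r \<notin> Units R"
    using s_props(3)
    by (metis Units_closed Units_inv_closed Units_l_inv l_one m_assoc r_null socle_gen_carrier)
next
  assume "r \<notin> Units R"
  then obtain t where t: "t \<in> carrier R" "r = t \<otimes> \<gamma>"
    using r nonunits_eq by (auto simp: left_multiples_def)
  have "\<gamma> \<otimes> socle_gen = \<gamma> [^] s"
    using s_props(1) nat_pow_Suc2[OF gamma_carrier, of "s - 1"] by (simp add: socle_gen_def)
  then show "r \<otimes> socle_gen = \<zero>" using t s_props(2) by (simp add: m_assoc)
qed

text \<open>First isomorphism theorem for the additive map \<open>?h\<close>, which is onto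
  \<open>socle\<close> with kernel \<open>Idl {\<gamma>}\<close>.\<close>

lemma card_socle: "card socle = residue_size R \<gamma>"
proof -
  let ?h = "\<lambda>r. r \<otimes> socle_gen"
  let ?H = "(add_monoid R)\<lparr>carrier := socle\<rparr>"
  interpret S: ideal socle R by (rule ideal_socle)
  have H: "Group.group ?H"
    using subgroup.subgroup_is_group[OF S.a_subgroup a_group] .
  have hom: "?h \<in> hom (add_monoid R) ?H"
    by (auto simp: hom_def socle_def left_multiples_def l_distr)
  interpret h: group_hom "add_monoid R" ?H ?h
    using H hom a_group by (simp add: group_hom_def group_hom_axioms_def)
  have ker: "kernel (add_monoid R) ?H ?h = Idl {\<gamma>}"
    using mult_socle_gen_eq_zero_iff by (auto simp: kernel_def Idl_gamma)
  have "bij_betw (\<lambda>Y. the_elem (?h ` Y)) (carrier (add_monoid R Mod (Idl {\<gamma>}))) socle"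
    using h.FactGroup_iso_set unfolding ker by (simp add: iso_def socle_def left_multiples_def)
  \<comment> \<open>The factor group and the factor ring consist of the same additive cosets, which
    carries the count over to the residue field.\<close>
  moreover have "carrier (add_monoid R Mod (Idl {\<gamma>})) = carrier (R Quot (Idl {\<gamma>}))"
    by (simp add: FactGroup_def FactRing_def A_RCOSETS_def)
  ultimately show ?thesis by (simp add: residue_size_def bij_betw_same_card)
qed

text \<open>If the inclusion failed, the chain condition would put the nonzero \<open>x\<close> into
  \<open>socle\<close>, as \<open>r \<otimes> socle_gen\<close> with \<open>r\<close> a unit.
  Inverting \<open>r\<close> then gives the inclusion after all.\<close>

lemma socle_subset_left_multiples:
  assumes x: "x \<in> carrier R" "x \<noteq> \<zero>"
  shows "socle \<subseteq> left_multiples x"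
proof (rule ccontr)
  assume not: "\<not> socle \<subseteq> left_multiples x"
  then have "left_multiples x \<subseteq> socle"
    using left_ideals_chain[OF left_ideal_left_multiples left_ideal_left_multiples, of x socle_gen] x
    by (auto simp: socle_def)
  then obtain r where r: "r \<in> carrier R" "x = r \<otimes> socle_gen"
    using left_multiples_self[OF x(1)] by (auto simp: socle_def left_multiples_def)
  then have u: "r \<in> Units R" using x mult_socle_gen_eq_zero_iff by blast
  have "t \<otimes> socle_gen = (t \<otimes> inv r) \<otimes> x" if "t \<in> carrier R" for t
    using r u that by (simp add: m_assoc) (simp flip: m_assoc)
  then have "socle \<subseteq> left_multiples x"
    using u by (force simp: socle_def left_multiples_def)
  then show False using not by simp
qed

definition "q = residue_size R \<gamma>"

lemma finite_socle: "finite socle"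
  using finite_carrier by (simp add: socle_def left_multiples_def)

lemma q_ge_2: "q \<ge> 2"
proof -
  interpret S: ideal socle R by (rule ideal_socle)
  have "{\<zero>, socle_gen} \<subseteq> socle"
    using left_multiples_self[OF socle_gen_carrier] S.zero_closed by (simp add: socle_def)
  then have "card {\<zero>, socle_gen} \<le> card socle" by (rule card_mono[OF finite_socle])
  then show ?thesis using s_props(3) by (simp add: card_socle q_def)
qed

text \<open>The weight becomes affine in two indicators, so its sums reduce to counting. Since
  \<open>\<zero>\<close> lies in \<open>socle\<close>, both indicators are 1 there and the value is
  \<open>1 + (1 - q) / (q - 1) = 0\<close>.\<close>

lemma hom_weight_eq:
  "hom_weight R \<gamma> x =
     1 + (of_bool (x \<in> socle) - real q * of_bool (x = \<zero>)) / (real q - 1)"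
proof -
  interpret S: ideal socle R by (rule ideal_socle)
  have "real q - 1 \<noteq> 0" using q_ge_2 by simp
  then have "real q / (real q - 1) = 1 + 1 / (real q - 1)" "1 + - real q / (real q - 1) + 1 / (real q - 1) = 0"
    by (simp_all add: divide_simps)
  then show ?thesis
    unfolding hom_weight_def Idl_socle_gen q_def[symmetric]
    by (cases "x = \<zero>"; cases "x \<in> socle") (simp_all add: diff_divide_distrib)
qed

end

section \<open>The Plotkin bound\<close>

lemma sum_coincidences:
  fixes f :: "'b \<Rightarrow> 'c"
  assumes "finite A" "f \<in> C \<rightarrow> A"
  shows "(\<Sum>x\<in>C. \<Sum>y\<in>C. of_bool (f x = h (f y)) :: real) =
    (\<Sum>a\<in>A. (\<Sum>y\<in>C. of_bool (f y = a)) * (\<Sum>x\<in>C. of_bool (f x = h a)))"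
proof -
  \<comment> \<open>The pairs are sorted by the value of \<open>f y\<close>, which equals exactly
    one \<open>a\<close> in \<open>A\<close>.\<close>
  have "(\<Sum>x\<in>C. \<Sum>y\<in>C. of_bool (f x = h (f y)) :: real) =
    (\<Sum>x\<in>C. \<Sum>y\<in>C. \<Sum>a\<in>A. of_bool (f y = a) * of_bool (f x = h a))"
  proof (intro sum.cong refl)
    fix x y assume "x \<in> C" "y \<in> C"
    have "(\<Sum>a\<in>A. of_bool (f y = a) * of_bool (f x = h a)) =
      (\<Sum>a\<in>A. if f y = a then of_bool (f x = h a) else (0::real))"
      by (intro sum.cong) auto
    then show "of_bool (f x = h (f y)) =
        (\<Sum>a\<in>A. of_bool (f y = a) * of_bool (f x = h a) :: real)"
      using assms \<open>y \<in> C\<close> by (auto simp: sum.delta)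
  qed
  also have "\<dots> = (\<Sum>x\<in>C. \<Sum>a\<in>A. \<Sum>y\<in>C. of_bool (f y = a) * of_bool (f x = h a))"
    by (intro sum.cong refl sum.swap)
  also have "\<dots> = (\<Sum>a\<in>A. \<Sum>x\<in>C. \<Sum>y\<in>C. of_bool (f y = a) * of_bool (f x = h a))"
    by (rule sum.swap)
  also have "\<dots> = (\<Sum>a\<in>A. (\<Sum>y\<in>C. of_bool (f y = a)) * (\<Sum>x\<in>C. of_bool (f x = h a)))"
    by (simp add: sum_distrib_left sum_distrib_right)
  finally show ?thesis .
qed

text \<open>With \<open>m a\<close> the size of the fibre over \<open>a\<close>, the left side is
  the sum of \<open>m a * m (h a)\<close> and the right side that of \<open>m a ^ 2\<close>. A
  product is at most the mean of the squares, and \<open>h\<close> preserves the sum of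
  squares.\<close>

lemma sum_coincidences_permuted_le:
  fixes f :: "'b \<Rightarrow> 'c"
  assumes A: "finite A" "f \<in> C \<rightarrow> A" and h: "bij_betw h A A"
  shows "(\<Sum>x\<in>C. \<Sum>y\<in>C. of_bool (f x = h (f y)) :: real) \<le>
    (\<Sum>x\<in>C. \<Sum>y\<in>C. of_bool (f x = f y))"
proof -
  define m :: "'c \<Rightarrow> real" where "m a = (\<Sum>x\<in>C. of_bool (f x = a))" for a
  have "(\<Sum>x\<in>C. \<Sum>y\<in>C. of_bool (f x = h (f y)) :: real) = (\<Sum>a\<in>A. m a * m (h a))"
    using sum_coincidences[OF A, of h] by (simp add: m_def)
  also have "\<dots> \<le> (\<Sum>a\<in>A. (m a ^ 2 + m (h a) ^ 2) / 2)"
  proof (rule sum_mono)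
    fix a
    have "0 \<le> (m a - m (h a)) ^ 2" by simp
    then show "m a * m (h a) \<le> (m a ^ 2 + m (h a) ^ 2) / 2"
      by (simp add: power2_eq_square algebra_simps)
  qed
  also have "\<dots> = ((\<Sum>a\<in>A. m a ^ 2) + (\<Sum>a\<in>A. m (h a) ^ 2)) / 2"
    by (simp add: sum.distrib flip: sum_divide_distrib)
  also have "(\<Sum>a\<in>A. m (h a) ^ 2) = (\<Sum>a\<in>A. m a ^ 2)"
    by (rule sum.reindex_bij_betw[OF h])
  also have "((\<Sum>a\<in>A. m a ^ 2) + (\<Sum>a\<in>A. m a ^ 2)) / 2 = (\<Sum>x\<in>C. \<Sum>y\<in>C. of_bool (f x = f y))"
    using sum_coincidences[OF A, of "\<lambda>a. a"] by (simp add: m_def power2_eq_square)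
  finally show ?thesis .
qed

section \<open>Weights summed over pairs and over codewords\<close>

context finite_chain_ring_uniformizer
begin

lemma socle_subset: "socle \<subseteq> carrier R"
  by (auto simp: socle_def left_multiples_def)

lemma (in -) vectors_carrier:
  "x \<in> vectors R n \<Longrightarrow> i \<in> {1..n} \<Longrightarrow> x i \<in> carrier R"
  unfolding vectors_def by (rule PiE_mem)

lemma minus_eq_iff:
  "\<lbrakk>a \<in> carrier R; b \<in> carrier R; t \<in> carrier R\<rbrakk> \<Longrightarrow> a \<ominus> b = t \<longleftrightarrow> a = b \<oplus> t"
  by (metis a_comm a_assoc minus_eq a_inv_closed l_neg r_neg r_zero minus_closed)

lemma sum_hom_weight_differences_le:
  assumes C: "finite C" and f: "f \<in> C \<rightarrow> carrier R"
  shows "(\<Sum>x\<in>C. \<Sum>y\<in>C. hom_weight R \<gamma> (f x \<ominus> f y)) \<le> real (card C) ^ 2"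
proof -
  \<comment> \<open>\<open>?E\<close> counts the ordered pairs, diagonal included, on which
    \<open>f\<close> agrees; \<open>?B\<close> counts those whose values differ by an element of
    \<open>socle\<close>.\<close>
  let ?E = "\<Sum>x\<in>C. \<Sum>y\<in>C. of_bool (f x = f y) :: real"
  let ?B = "\<Sum>x\<in>C. \<Sum>y\<in>C. of_bool (f x \<ominus> f y \<in> socle) :: real"
  have "?B = (\<Sum>x\<in>C. \<Sum>y\<in>C. \<Sum>t\<in>socle. of_bool (f x = f y \<oplus> t))"
  proof (intro sum.cong refl)
    fix x y assume "x \<in> C" "y \<in> C"
    then have "f x \<in> carrier R" "f y \<in> carrier R" using f by auto
    then have "(\<Sum>t\<in>socle. of_bool (f x = f y \<oplus> t) :: real) =
        (\<Sum>t\<in>socle. if f x \<ominus> f y = t then 1 else 0)"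
      by (intro sum.cong refl) (use socle_subset in \<open>simp add: subset_iff of_bool_def flip: minus_eq_iff\<close>)
    then show "of_bool (f x \<ominus> f y \<in> socle) = (\<Sum>t\<in>socle. of_bool (f x = f y \<oplus> t) :: real)"
      using finite_socle by simp
  qed
  also have "\<dots> = (\<Sum>x\<in>C. \<Sum>t\<in>socle. \<Sum>y\<in>C. of_bool (f x = f y \<oplus> t))"
    by (intro sum.cong refl sum.swap)
  also have "\<dots> = (\<Sum>t\<in>socle. \<Sum>x\<in>C. \<Sum>y\<in>C. of_bool (f x = f y \<oplus> t))"
    by (rule sum.swap)
  also have "\<dots> \<le> (\<Sum>t\<in>socle. ?E)"
  proof (rule sum_mono)
    fix t assume "t \<in> socle"
    then have t: "t \<in> carrier R" using socle_subset by auto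
    have "inj_on (\<lambda>a. a \<oplus> t) (carrier R)" using t by (intro inj_onI) simp
    moreover have "(\<lambda>a. a \<oplus> t) ` carrier R \<subseteq> carrier R" using t by auto
    ultimately have "bij_betw (\<lambda>a. a \<oplus> t) (carrier R) (carrier R)"
      unfolding bij_betw_def using endo_inj_surj[OF finite_carrier] by blast
    then show "(\<Sum>x\<in>C. \<Sum>y\<in>C. of_bool (f x = f y \<oplus> t)) \<le> ?E"
      by (rule sum_coincidences_permuted_le[OF finite_carrier f])
  qed
  also have "\<dots> = real q * ?E" by (simp add: card_socle q_def)
  finally have B: "?B \<le> real q * ?E" .
  \<comment> \<open>In the affine form of the weight, the constant 1 contributes
    \<open>card C ^ 2\<close>, and the bound on \<open>?B\<close> makes the remaining part
    nonpositive.\<close>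
  have "(\<Sum>x\<in>C. \<Sum>y\<in>C. hom_weight R \<gamma> (f x \<ominus> f y)) =
    (\<Sum>x\<in>C. \<Sum>y\<in>C. 1 + (of_bool (f x \<ominus> f y \<in> socle) - real q * of_bool (f x = f y)) / (real q - 1))"
    using f by (intro sum.cong refl) (auto simp: hom_weight_eq Pi_iff minus_eq_iff)
  also have "\<dots> = real (card C) ^ 2 + (?B - real q * ?E) / (real q - 1)"
    by (simp add: sum.distrib sum_subtractf power2_eq_square flip: sum_divide_distrib sum_distrib_left)
  also have "\<dots> \<le> real (card C) ^ 2"
    using B q_ge_2 by (simp add: divide_nonpos_nonneg)
  finally show ?thesis .
qed

lemma sum_distances_le:
  assumes C: "finite C" and CV: "C \<subseteq> vectors R n"
  shows "(\<Sum>x\<in>C. \<Sum>y\<in>C. hom_weight_vec R \<gamma> n (vec_diff R n x y)) \<le> real n * real (card C) ^ 2"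
proof -
  have "(\<Sum>x\<in>C. \<Sum>y\<in>C. hom_weight_vec R \<gamma> n (vec_diff R n x y)) =
      (\<Sum>x\<in>C. \<Sum>y\<in>C. \<Sum>i=1..n. hom_weight R \<gamma> (x i \<ominus> y i))"
    by (simp add: hom_weight_vec_def vec_diff_def)
  also have "\<dots> = (\<Sum>x\<in>C. \<Sum>i=1..n. \<Sum>y\<in>C. hom_weight R \<gamma> (x i \<ominus> y i))"
    by (intro sum.cong refl sum.swap)
  also have "\<dots> = (\<Sum>i=1..n. \<Sum>x\<in>C. \<Sum>y\<in>C. hom_weight R \<gamma> (x i \<ominus> y i))"
    by (rule sum.swap)
  also have "\<dots> \<le> (\<Sum>i=1..n. real (card C) ^ 2)"
    using CV by (intro sum_mono sum_hom_weight_differences_le C) (auto intro: vectors_carrier)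
  finally show ?thesis by simp
qed

text \<open>The entries at \<open>i\<close> hit every element of \<open>socle\<close> equally often,
  so the two indicators in \<open>hom_weight_eq\<close> cancel exactly in the sum.\<close>

lemma sum_hom_weight_coordinate:
  assumes C: "finite C" and lin: "linear_code R n C" and i: "i \<in> {1..n}"
    and c: "c \<in> C" "c i \<noteq> \<zero>"
  shows "(\<Sum>x\<in>C. hom_weight R \<gamma> (x i)) = real (card C)"
proof -
  have CV: "C \<subseteq> vectors R n" using lin unfolding linear_code_def by (rule conjunct1)
  have car: "x j \<in> carrier R" if "x \<in> C" "j \<in> {1..n}" for x j
    using vectors_carrier[OF subsetD[OF CV that(1)] that(2)] .
  have eqI: "x = y" if "x \<in> C" "y \<in> C" "\<And>j. j \<in> {1..n} \<Longrightarrow> x j = y j" for x y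
  proof (rule PiE_ext)
    show "x \<in> {1..n} \<rightarrow>\<^sub>E carrier R" "y \<in> {1..n} \<rightarrow>\<^sub>E carrier R"
      using subsetD[OF CV] that(1,2) unfolding vectors_def by blast+
  qed (use that in auto)
  have fibre: "(\<Sum>x\<in>C. of_bool (x i = t) :: real) = (\<Sum>x\<in>C. of_bool (x i = \<zero>))"
    if "t \<in> socle" for t
  proof -
    \<comment> \<open>Since \<open>c i\<close> is nonzero, its left multiples include
      \<open>socle\<close>; hence some scalar multiple of \<open>c\<close> has the entry
      \<open>t\<close> at \<open>i\<close>.\<close>
    obtain r where r: "r \<in> carrier R" "t = r \<otimes> c i"
      using socle_subset_left_multiples[OF car[OF c(1) i] c(2)] \<open>t \<in> socle\<close>
      by (auto simp: left_multiples_def)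
    define b where "b = vec_lsmult R n r c"
    have b: "b \<in> C" "b i = t"
      using lin r c(1) i by (auto simp: b_def linear_code_def vec_lsmult_def)
    have "inj_on (\<lambda>x. vec_add R n x b) C"
    proof (rule inj_onI, rule eqI)
      fix x y j assume xy: "x \<in> C" "y \<in> C" "vec_add R n x b = vec_add R n y b" and j: "j \<in> {1..n}"
      from xy(3) have "vec_add R n x b j = vec_add R n y b j" by simp
      then show "x j = y j" using car[OF _ j] xy(1,2) b(1) j by (simp add: vec_add_def)
    qed
    moreover have "(\<lambda>x. vec_add R n x b) ` C \<subseteq> C"
      using lin b by (auto simp: linear_code_def)
    ultimately have "bij_betw (\<lambda>x. vec_add R n x b) C C"
      unfolding bij_betw_def using endo_inj_surj[OF C] by blast
    \<comment> \<open>Translation by \<open>b\<close> permutes \<open>C\<close> and takes the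
      codewords with entry \<open>\<zero>\<close> at \<open>i\<close> to those with entry
      \<open>t\<close>.\<close>
    then have "(\<Sum>x\<in>C. of_bool (x i = t) :: real) = (\<Sum>x\<in>C. of_bool (vec_add R n x b i = t))"
      by (rule sum.reindex_bij_betw[symmetric])
    also have "\<dots> = (\<Sum>x\<in>C. of_bool (x i = \<zero>))"
    proof (intro sum.cong refl)
      fix x assume "x \<in> C"
      then show "of_bool (vec_add R n x b i = t) = (of_bool (x i = \<zero>) :: real)"
        using car[OF _ i] b i by (auto simp: vec_add_def)
    qed
    finally show ?thesis .
  qed
  have "(\<Sum>x\<in>C. of_bool (x i \<in> socle) :: real) = (\<Sum>x\<in>C. \<Sum>t\<in>socle. of_bool (x i = t))"
  proof (intro sum.cong refl)
    fix x
    show "of_bool (x i \<in> socle) = (\<Sum>t\<in>socle. of_bool (x i = t) :: real)"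
      using finite_socle by (simp add: of_bool_def)
  qed
  also have "\<dots> = (\<Sum>t\<in>socle. \<Sum>x\<in>C. of_bool (x i = t))" by (rule sum.swap)
  also have "\<dots> = real q * (\<Sum>x\<in>C. of_bool (x i = \<zero>))"
    using fibre by (simp add: card_socle q_def)
  finally show ?thesis
    by (simp add: hom_weight_eq sum.distrib sum_subtractf
        flip: sum_divide_distrib sum_distrib_left)
qed

lemma sum_hom_weight_code:
  assumes C: "finite C" and lin: "linear_code R n C" and nd: "nondegenerate_code R n C"
  shows "(\<Sum>c\<in>C. hom_weight_vec R \<gamma> n c) = real n * real (card C)"
proof -
  have "(\<Sum>c\<in>C. hom_weight_vec R \<gamma> n c) = (\<Sum>i=1..n. \<Sum>c\<in>C. hom_weight R \<gamma> (c i))"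
    unfolding hom_weight_vec_def by (rule sum.swap)
  also have "\<dots> = (\<Sum>i=1..n. real (card C))"
  proof (intro sum.cong refl)
    fix i assume i: "i \<in> {1..n}"
    then obtain c where "c \<in> C" "c i \<noteq> \<zero>" using nd unfolding nondegenerate_code_def by blast
    then show "(\<Sum>c\<in>C. hom_weight R \<gamma> (c i)) = real (card C)"
      by (rule sum_hom_weight_coordinate[OF C lin i])
  qed
  finally show ?thesis by simp
qed

section \<open>Distances and the minimum distance\<close>

lemma hom_weight_vec_zero: "hom_weight_vec R \<gamma> n (vec_zero R n) = 0"
  by (simp add: hom_weight_vec_def vec_zero_def hom_weight_def)

lemma vec_diff_self: "x \<in> vectors R n \<Longrightarrow> vec_diff R n x x = vec_zero R n"
  unfolding vec_diff_def vec_zero_def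
  by (intro restrict_ext) (metis minus_eq r_neg vectors_carrier)

lemma vec_diff_zero:
  assumes "x \<in> vectors R n"
  shows "vec_diff R n x (vec_zero R n) = x"
proof (rule PiE_ext)
  show "x \<in> {1..n} \<rightarrow>\<^sub>E carrier R" using assms by (simp add: vectors_def)
  then show "vec_diff R n x (vec_zero R n) \<in> {1..n} \<rightarrow>\<^sub>E carrier R"
    by (auto simp: vec_diff_def vec_zero_def)
  fix i assume "i \<in> {1..n}"
  then show "vec_diff R n x (vec_zero R n) i = x i"
    using vectors_carrier[OF assms] by (simp add: vec_diff_def vec_zero_def minus_eq)
qed

lemma min_hom_dist_le:
  assumes "finite C" "x \<in> C" "y \<in> C" "x \<noteq> y"
  shows "min_hom_dist R \<gamma> n C \<le> hom_weight_vec R \<gamma> n (vec_diff R n x y)"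
  unfolding min_hom_dist_def
proof (rule Min_le)
  have "{hom_weight_vec R \<gamma> n (vec_diff R n x y) |x y. x \<in> C \<and> y \<in> C \<and> x \<noteq> y} \<subseteq>
    (\<lambda>(x, y). hom_weight_vec R \<gamma> n (vec_diff R n x y)) ` (C \<times> C)" by auto
  then show "finite {hom_weight_vec R \<gamma> n (vec_diff R n x y) |x y. x \<in> C \<and> y \<in> C \<and> x \<noteq> y}"
    using assms(1) by (meson finite_SigmaI finite_imageI finite_subset)
qed (use assms in auto)

text \<open>Source of both the bound and its equality case. With \<open>?M = card C\<close>, the
  off-diagonal pairs number \<open>?M * (?M - 1)\<close>, and their distances sum to at most
  \<open>n * ?M ^ 2\<close>.\<close>

lemma sum_excess_le:
  assumes C: "finite C" "C \<subseteq> vectors R n"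
  shows "(\<Sum>(x, y)\<in>C \<times> C - Id. hom_weight_vec R \<gamma> n (vec_diff R n x y) - min_hom_dist R \<gamma> n C)
    \<le> real (card C) * (real (card C) * real n - (real (card C) - 1) * min_hom_dist R \<gamma> n C)"
proof -
  let ?D = "\<lambda>x y. hom_weight_vec R \<gamma> n (vec_diff R n x y)"
  let ?d = "min_hom_dist R \<gamma> n C"
  let ?M = "real (card C)"
  have diag: "C \<times> C \<inter> Id = (\<lambda>x. (x, x)) ` C" by auto
  have "card (C \<times> C \<inter> Id) = card C" unfolding diag by (intro card_image inj_onI) auto
  moreover have "card (C \<times> C) = card (C \<times> C \<inter> Id) + card (C \<times> C - Id)"
    using C card_Int_Diff[of "C \<times> C" Id] by simp
  ultimately have "card C * card C = card C + card (C \<times> C - Id)"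
    by (simp add: card_cartesian_product)
  then have "real (card C * card C) = real (card C + card (C \<times> C - Id))" by (rule arg_cong)
  then have card: "real (card (C \<times> C - Id)) = ?M * (?M - 1)"
    by (simp add: algebra_simps)
  \<comment> \<open>A diagonal pair has difference zero, so including the diagonal leaves the sum
    unchanged.\<close>
  have "(\<Sum>(x, y)\<in>C \<times> C - Id. ?D x y) = (\<Sum>(x, y)\<in>C \<times> C. ?D x y)"
    using C by (intro sum.mono_neutral_left) (auto simp: vec_diff_self hom_weight_vec_zero)
  also have "\<dots> = (\<Sum>x\<in>C. \<Sum>y\<in>C. ?D x y)"
    by (rule sum.cartesian_product[symmetric])
  also have "\<dots> \<le> real n * ?M ^ 2" by (rule sum_distances_le[OF C])
  finally have "(\<Sum>(x, y)\<in>C \<times> C - Id. ?D x y) \<le> real n * ?M ^ 2" .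
  moreover have "(\<Sum>(x, y)\<in>C \<times> C - Id. ?D x y - ?d) = (\<Sum>(x, y)\<in>C \<times> C - Id. ?D x y) - ?M * (?M - 1) * ?d"
    by (simp add: case_prod_unfold sum_subtractf card)
  ultimately show ?thesis by (simp add: power2_eq_square algebra_simps)
qed

text \<open>Every distance is at least the minimum, so the upper estimate for the total excess is
  nonnegative; its positive factor \<open>card C\<close> is then cancelled.\<close>

lemma min_hom_dist_bound:
  assumes C: "C \<subseteq> vectors R n" "card C \<ge> 2"
  shows "(real (card C) - 1) * min_hom_dist R \<gamma> n C \<le> real (card C) * real n"
proof -
  have fin: "finite C" using C(2) by (intro card_ge_0_finite) simp
  have "0 \<le> (\<Sum>(x, y)\<in>C \<times> C - Id. hom_weight_vec R \<gamma> n (vec_diff R n x y) - min_hom_dist R \<gamma> n C)"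
    by (intro sum_nonneg) (auto intro: min_hom_dist_le[OF fin])
  then have "0 \<le> real (card C) * (real (card C) * real n - (real (card C) - 1) * min_hom_dist R \<gamma> n C)"
    using sum_excess_le[OF fin C(1)] by linarith
  then show ?thesis using C(2) by (simp add: zero_le_mult_iff)
qed

text \<open>Equality turns the upper estimate for the total excess into zero, and nonnegative terms
  with sum zero all vanish.\<close>

lemma equidistant_if_bound_attained:
  assumes C: "C \<subseteq> vectors R n" "card C \<ge> 2"
    and eq: "(real (card C) - 1) * min_hom_dist R \<gamma> n C = real (card C) * real n"
    and xy: "x \<in> C" "y \<in> C" "x \<noteq> y"
  shows "hom_weight_vec R \<gamma> n (vec_diff R n x y) = min_hom_dist R \<gamma> n C"
proof -
  let ?g = "\<lambda>(x, y). hom_weight_vec R \<gamma> n (vec_diff R n x y) - min_hom_dist R \<gamma> n C"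
  have fin: "finite C" using C(2) by (intro card_ge_0_finite) simp
  have nonneg: "0 \<le> ?g p" if "p \<in> C \<times> C - Id" for p
    using that by (auto intro: min_hom_dist_le[OF fin])
  have "sum ?g (C \<times> C - Id) \<le> 0" using sum_excess_le[OF fin C(1)] eq by simp
  with sum_nonneg[OF nonneg] have "sum ?g (C \<times> C - Id) = 0" by (rule order_antisym[rotated])
  then have "\<forall>p\<in>C \<times> C - Id. ?g p = 0"
    using fin nonneg by (subst (asm) sum_nonneg_eq_0_iff) auto
  from bspec[OF this, of "(x, y)"] show ?thesis using xy by simp
qed

text \<open>The total weight is counted twice: by coordinates it is \<open>n * card C\<close>, by
  codewords it is the minimum distance times the number of nonzero codewords.\<close>

lemma constant_weight_attains_bound:
  assumes C: "finite C" and lin: "linear_code R n C" and nd: "nondegenerate_code R n C"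
    and const: "constant_hom_weight R \<gamma> n C"
  shows "(real (card C) - 1) * min_hom_dist R \<gamma> n C = real (card C) * real n"
proof -
  have z: "vec_zero R n \<in> C" using lin by (simp add: linear_code_def)
  have "real n * real (card C) = (\<Sum>c\<in>C. hom_weight_vec R \<gamma> n c)"
    using sum_hom_weight_code[OF C lin nd] by simp
  also have "\<dots> = (\<Sum>c\<in>C - {vec_zero R n}. hom_weight_vec R \<gamma> n c)"
    using C z by (simp add: sum.remove hom_weight_vec_zero)
  also have "\<dots> = real (card (C - {vec_zero R n})) * min_hom_dist R \<gamma> n C"
    using const by (simp add: constant_hom_weight_def)
  also have "real (card (C - {vec_zero R n})) = real (card C) - 1"
    using card_Suc_Diff1[OF C z] by simp
  finally show ?thesis by (simp add: mult.commute)
qed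

end

theorem theorem31:
  fixes R :: "('a, 'm) ring_scheme" and \<gamma> :: 'a and n :: nat and C :: "(nat \<Rightarrow> 'a) set"
  assumes "finite_chain_ring R"
    and "\<gamma> \<in> carrier R" and "maximalideal (Idl\<^bsub>R\<^esub> {\<gamma>}) R"
    and "n \<ge> 1"
    and "C \<subseteq> vectors R n" and "card C \<ge> 2"
  shows "min_hom_dist R \<gamma> n C \<le> real (card C) / (real (card C) - 1) * real n \<and>
    (linear_code R n C \<longrightarrow>
       (min_hom_dist R \<gamma> n C = real (card C) / (real (card C) - 1) * real n \<longrightarrow>
          constant_hom_weight R \<gamma> n C) \<and>
       (nondegenerate_code R n C \<longrightarrow>
          (min_hom_dist R \<gamma> n C = real (card C) / (real (card C) - 1) * real n \<longleftrightarrow>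
             constant_hom_weight R \<gamma> n C)))"
proof -
  interpret finite_chain_ring_uniformizer R \<gamma>
    using assms by (simp add: finite_chain_ring_uniformizer_def finite_chain_ring_uniformizer_axioms_def)
  let ?M = "real (card C)" and ?d = "min_hom_dist R \<gamma> n C"
  have fin: "finite C" using assms(6) by (intro card_ge_0_finite) simp
  have M: "?M - 1 > 0" using assms(6) by simp
  have eq_iff: "?d = ?M / (?M - 1) * real n \<longleftrightarrow> (?M - 1) * ?d = ?M * real n"
    using M by (auto simp: field_simps)
  have "?d \<le> ?M / (?M - 1) * real n"
    using min_hom_dist_bound[OF assms(5,6)] M by (simp add: field_simps)
  moreover have "constant_hom_weight R \<gamma> n C"
    if lin: "linear_code R n C" and "?d = ?M / (?M - 1) * real n"
    unfolding constant_hom_weight_def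
  proof
    fix c assume c: "c \<in> C - {vec_zero R n}"
    \<comment> \<open>The weight of a codeword is its distance from the zero codeword, so
      equidistance yields constant weight.\<close>
    have "hom_weight_vec R \<gamma> n (vec_diff R n c (vec_zero R n)) = ?d"
      using that c eq_iff
      by (intro equidistant_if_bound_attained[OF assms(5,6)]) (auto simp: linear_code_def)
    then show "hom_weight_vec R \<gamma> n c = ?d" using c assms(5) by (auto simp: vec_diff_zero)
  qed
  moreover have "?d = ?M / (?M - 1) * real n"
    if "linear_code R n C" "nondegenerate_code R n C" "constant_hom_weight R \<gamma> n C"
    using constant_weight_attains_bound[OF fin that] eq_iff by simp
  ultimately show ?thesis by blast
qed

end
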